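(* Let $p$ be a prime, let $m,n$ be positive integers, put $l=\frac{p^n-1}{p-1}$, and for $1\le j\le m$ let $N_j=\sum_{k=j}^{m} p^{(k-j)(n-1)}\phi(p^k)$ (i.e. $N_j=\phi(p^j)+p^{n-1}(\phi(p^{j+1})+p^{n-1}(\cdots+p^{n-1}\phi(p^m))\cdots)$). Then the Laplacian polynomial of the power graph $\mathcal{G}(\mathbb{Z}_{p^m}^n)$ is \[ x(x-p^{mn})(x-1)^{l-1}(x-p^m)^{l p^{(m-1)(n-1)}(\phi(p^m)-1)}\left(\prod_{i=1}^{m-1}(x-p^i)^{l p^{(i-1)(n-1)}(p^{n-1}-1)}\right)\left(\prod_{i=1}^{m-1}\bigl(x-p^i-p^{n-1}N_{i+1}\bigr)^{l p^{(i-1)(n-1)}\phi(p^i)}\right), \] where empty products equal $1$.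
   Context: $\phi$ is Euler's totient function. For a finite group $G$, the power graph $\mathcal{G}(G)$ is the simple graph with vertex set $G$ in which two distinct vertices are adjacent if and only if one is a power of the other. $\mathbb{Z}_k^n$ is the direct product of $n$ copies of the cyclic group $\mathbb{Z}_k$ of order $k$. The Laplacian polynomial of a finite simple graph $\Gamma$ is $\det(xI-L(\Gamma))$ where $L(\Gamma)=D(\Gamma)-A(\Gamma)$ is the degree diagonal matrix minus the adjacency matrix. *)

theory Defs
  imports
    "HOL-Number_Theory.Totient"
    "HOL-Algebra.Elementary_Groups"
    "HOL-Algebra.Product_Groups"
    "Graph_Theory.Pair_Digraph"
    "Jordan_Normal_Form.Char_Poly"
begin

text \<open>
  A finite simple graph is a \<^locale>\<open>pair_graph\<close>: each edge is present as a pair of opposite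
  arcs, so the degree of a vertex is its \<^const>\<open>out_degree\<close>.
\<close>

definition power_graph :: "('a, 'b) monoid_scheme \<Rightarrow> 'a pair_pre_digraph" where
  "power_graph G = \<lparr> pverts = carrier G,
     parcs = {(x, y). x \<in> carrier G \<and> y \<in> carrier G \<and> x \<noteq> y \<and>
                ((\<exists>k::nat. x = y [^]\<^bsub>G\<^esub> k) \<or> (\<exists>k::nat. y = x [^]\<^bsub>G\<^esub> k))} \<rparr>"

lemma pair_graph_power_graph:
  assumes "finite (carrier G)"
  shows "pair_graph (power_graph G)"
proof -
  have "parcs (power_graph G) \<subseteq> carrier G \<times> carrier G"
    by (auto simp: power_graph_def)
  then have "finite (parcs (power_graph G))"
    using assms by (meson finite_SigmaI finite_subset)
  then show ?thesis
    using assms by unfold_locales (auto simp: power_graph_def symmetric_def intro!: symI)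
qed

text \<open>
  The matrices of a graph are taken with respect to an enumeration \<open>vs\<close> of its vertices,
  without repetitions.
\<close>

definition adjacency_mat :: "'a pair_pre_digraph \<Rightarrow> 'a list \<Rightarrow> int mat" where
  "adjacency_mat \<Gamma> vs =
     mat (length vs) (length vs) (\<lambda>(i, j). if (vs ! i, vs ! j) \<in> parcs \<Gamma> then 1 else 0)"

definition degree_mat :: "'a pair_pre_digraph \<Rightarrow> 'a list \<Rightarrow> int mat" where
  "degree_mat \<Gamma> vs =
     mat (length vs) (length vs)
       (\<lambda>(i, j). if i = j then int (out_degree (with_proj \<Gamma>) (vs ! i)) else 0)"

definition laplacian_mat :: "'a pair_pre_digraph \<Rightarrow> 'a list \<Rightarrow> int mat" where
  "laplacian_mat \<Gamma> vs = degree_mat \<Gamma> vs - adjacency_mat \<Gamma> vs"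

definition laplacian_poly :: "'a pair_pre_digraph \<Rightarrow> 'a list \<Rightarrow> int poly" where
  "laplacian_poly \<Gamma> vs = char_poly (laplacian_mat \<Gamma> vs)"

definition cyclic_power_group :: "nat \<Rightarrow> nat \<Rightarrow> (nat \<Rightarrow> int) monoid" where
  "cyclic_power_group k n = product_group {..<n} (\<lambda>_. integer_mod_group k)"

end

theory Submission
  imports Defs "HOL-Algebra.Multiplicative_Group"
begin

text \<open>
  In a group of exponent \<open>p ^ m\<close> the subgroups of a cyclic subgroup form a chain, so the power graph
  is the comparability graph of a tree of cliques, namely of the sets of generators of the cyclic
  subgroups.
  Let \<open>U\<close> be the set of all \<open>y\<close> having \<open>x\<close> as a power. The principal submatrix of \<open>XI - L\<close> on \<open>U\<close>
  has constant row sums, since every vertex of \<open>U\<close> has the same neighbours outside \<open>U\<close>, namely the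
  non-generators of \<open>\<langle>x\<rangle>\<close>. For such a matrix, subtracting the all-ones matrix changes the
  determinant by an explicit factor; and it makes the rows of the generators of \<open>\<langle>x\<rangle>\<close> diagonal,
  so that the determinant reduces to those of the disjoint cones one level higher. In \<open>\<int>_{p^m}^n\<close> every
  cyclic subgroup of order \<open>p ^ i\<close>, \<open>1 \<le> i < m\<close>, lies in \<open>p ^ (n - 1)\<close> cyclic subgroups of order
  \<open>p ^ (i + 1)\<close>, because all fibres of \<open>y \<mapsto> p y\<close> over its image have size \<open>p ^ n\<close>.
\<close>

section \<open>Determinants indexed by finite sets\<close>

definition list_det :: "'a list \<Rightarrow> ('a \<Rightarrow> 'a \<Rightarrow> 'b::comm_ring_1) \<Rightarrow> 'b" where
  "list_det vs A = det (mat (length vs) (length vs) (\<lambda>(i, j). A (vs ! i) (vs ! j)))"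

text \<open>The choice of enumeration is harmless by \<open>list_det_permute\<close>, so
  determinants can be indexed by vertex sets and split along disjoint unions.\<close>

definition set_det :: "'a set \<Rightarrow> ('a \<Rightarrow> 'a \<Rightarrow> 'b::comm_ring_1) \<Rightarrow> 'b" where
  "set_det S A = list_det (SOME vs. distinct vs \<and> set vs = S) A"

text \<open>Reordering permutes rows and columns by the same permutation, so its sign enters twice
  and squares to 1.\<close>

lemma list_det_permute:
  assumes "mset vs = mset ws"
  shows "list_det vs A = list_det ws A"
proof -
  obtain p where p: "p permutes {..<length ws}" and vs: "permute_list p ws = vs"
    using mset_eq_permutation[OF assms] by blast
  define n where "n = length ws"
  have len: "length vs = n"
    using assms n_def mset_eq_length by blast
  have nth: "vs ! i = ws ! p i" if "i < n" for i
    using that vs p permute_list_nth n_def by metis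
  have p0: "p permutes {0..<n}"
    using p by (simp add: n_def atLeast0LessThan)
  have pn: "p i < n" if "i < n" for i
    using that permutes_in_image[OF p0, of i] by simp
  define M where "M = mat n n (\<lambda>(i, j). A (ws ! i) (ws ! j))"
  define R where "R = mat n n (\<lambda>(i, j). A (ws ! p i) (ws ! j))"
  have M: "M \<in> carrier_mat n n" and R: "R \<in> carrier_mat n n"
    by (auto simp: M_def R_def)
  have "det R = signof p * det M"
  proof -
    have "R = mat n n (\<lambda>(i, j). M $$ (p i, j))"
      using pn by (intro eq_matI) (auto simp: M_def R_def)
    then show ?thesis
      using det_permute_rows[OF M p0] by simp
  qed
  \<comment> \<open>The columns of \<open>R\<close> are permuted as rows of its transpose.\<close>
  moreover have "det (mat n n (\<lambda>(i, j). R\<^sup>T $$ (p i, j))) = signof p * det R"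
    using det_permute_rows[OF transpose_carrier_mat[THEN iffD2, OF R] p0] det_transpose[OF R] by simp
  moreover have "mat n n (\<lambda>(i, j). R\<^sup>T $$ (p i, j)) = (mat n n (\<lambda>(i, j). A (vs ! i) (vs ! j)))\<^sup>T"
    using pn nth by (intro eq_matI) (auto simp: R_def)
  ultimately have "det (mat n n (\<lambda>(i, j). A (vs ! i) (vs ! j))) = signof p * (signof p * det M)"
    using det_transpose[of "mat n n (\<lambda>(i, j). A (vs ! i) (vs ! j))" n] by simp
  also have "\<dots> = det M"
    by (simp add: sign_def)
  finally show ?thesis
    by (simp add: list_det_def M_def len n_def)
qed

lemma set_det_eq_list_det:
  assumes "distinct vs" and "set vs = S"
  shows "set_det S A = list_det vs A"
proof -
  have "distinct (SOME vs. distinct vs \<and> set vs = S) \<and> set (SOME vs. distinct vs \<and> set vs = S) = S"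
    by (rule someI[where x = vs]) (use assms in simp)
  then show ?thesis
    using assms unfolding set_det_def
    by (intro list_det_permute) (metis set_eq_iff_mset_eq_distinct)
qed

lemma set_det_empty [simp]: "set_det {} A = 1"
  by (simp add: set_det_eq_list_det[of "[]"] list_det_def)

lemma set_det_singleton [simp]: "set_det {x} A = A x x"
  by (simp add: set_det_eq_list_det[of "[x]"] list_det_def det_single)

text \<open>Listing \<open>S\<close> before \<open>T\<close> gives a block lower triangular matrix;
  the block from \<open>T\<close> to \<open>S\<close> may be arbitrary.\<close>

lemma set_det_Un:
  fixes A :: "'a \<Rightarrow> 'a \<Rightarrow> 'b::idom"
  assumes "finite S" and "finite T" and "S \<inter> T = {}"
    and zero: "\<And>x y. x \<in> S \<Longrightarrow> y \<in> T \<Longrightarrow> A x y = 0"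
  shows "set_det (S \<union> T) A = set_det S A * set_det T A"
proof -
  obtain us ws where us: "distinct us" "set us = S" and ws: "distinct ws" "set ws = T"
    using assms finite_distinct_list by metis
  let ?n = "length us" and ?k = "length ws"
  define B where "B = four_block_mat (mat ?n ?n (\<lambda>(i, j). A (us ! i) (us ! j))) (0\<^sub>m ?n ?k)
    (mat ?k ?n (\<lambda>(i, j). A (ws ! i) (us ! j))) (mat ?k ?k (\<lambda>(i, j). A (ws ! i) (ws ! j)))"
  have "mat (length (us @ ws)) (length (us @ ws)) (\<lambda>(i, j). A ((us @ ws) ! i) ((us @ ws) ! j)) = B"
    unfolding B_def using zero us ws
    by (intro eq_matI) (auto simp: nth_append)
  moreover have "det B = list_det us A * list_det ws A"
    unfolding B_def list_det_def by (rule det_four_block_mat_upper_right_zero) auto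
  moreover have "distinct (us @ ws)" "set (us @ ws) = S \<union> T"
    using us ws assms(3) by auto
  ultimately show ?thesis
    using us ws set_det_eq_list_det[of "us @ ws" "S \<union> T" A]
    by (simp add: set_det_eq_list_det list_det_def)
qed

lemma set_det_diagonal:
  fixes A :: "'a \<Rightarrow> 'a \<Rightarrow> 'b::idom"
  assumes "finite S" and "\<And>x. x \<in> S \<Longrightarrow> A x x = q"
    and "\<And>x y. x \<in> S \<Longrightarrow> y \<in> S \<Longrightarrow> x \<noteq> y \<Longrightarrow> A x y = 0"
  shows "set_det S A = q ^ card S"
  using assms
proof (induction S rule: finite_induct)
  case (insert x S)
  have "set_det ({x} \<union> S) A = set_det {x} A * set_det S A"
    using insert by (intro set_det_Un) auto
  then show ?case
    using insert by simp
qed simp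

lemma set_det_Union:
  fixes A :: "'a \<Rightarrow> 'a \<Rightarrow> 'b::idom"
  assumes "finite \<C>" and "\<And>C. C \<in> \<C> \<Longrightarrow> finite C" and "disjoint \<C>"
    and "\<And>C D x y. C \<in> \<C> \<Longrightarrow> D \<in> \<C> \<Longrightarrow> C \<noteq> D \<Longrightarrow> x \<in> C \<Longrightarrow> y \<in> D \<Longrightarrow> A x y = 0"
  shows "set_det (\<Union>\<C>) A = (\<Prod>C\<in>\<C>. set_det C A)"
  using assms
proof (induction \<C> rule: finite_induct)
  case (insert C \<C>)
  have "C \<inter> \<Union>\<C> = {}"
    using insert.prems(2) insert.hyps(2) by (auto simp: disjoint_def)
  moreover have "A x y = 0" if "x \<in> C" "y \<in> \<Union>\<C>" for x y
    using that insert.prems(3)[of C] insert.hyps(2) by (metis UnionE insertCI)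
  ultimately have "set_det (C \<union> \<Union>\<C>) A = set_det C A * set_det (\<Union>\<C>) A"
    using insert.hyps insert.prems(1) by (intro set_det_Un) auto
  moreover have "set_det (\<Union>\<C>) A = (\<Prod>C\<in>\<C>. set_det C A)"
  proof (rule insert.IH)
    show "disjoint \<C>"
      using insert.prems(2) by (simp add: disjoint_def)
    show "A x y = 0" if "C \<in> \<C>" "D \<in> \<C>" "C \<noteq> D" "x \<in> C" "y \<in> D" for C D x y
      using that insert.prems(3) by blast
  qed (use insert.prems(1) in blast)
  ultimately show ?case
    using insert.hyps by simp
qed simp

text \<open>
  Adding all columns to the first one turns it into a multiple of the all-ones vector, which then
  clears the constant \<open>t\<close> from the other columns; what remains does not depend on \<open>t\<close>.
\<close>

lemma set_det_add_const:
  fixes A :: "'a \<Rightarrow> 'a \<Rightarrow> 'b::idom"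
  assumes "finite S" and rows: "\<And>x. x \<in> S \<Longrightarrow> (\<Sum>y\<in>S. A x y) = r"
  shows "r * set_det S (\<lambda>x y. A x y + t) = (r + t * of_nat (card S)) * set_det S A"
proof (cases "S = {}")
  case False
  obtain vs where vs: "distinct vs" "set vs = S"
    using finite_distinct_list[OF assms(1)] by blast
  define n where "n = length vs"
  have n: "n > 0" "card S = n"
    using False vs distinct_card[of vs] by (auto simp: n_def)
  \<comment> \<open>Multiplying by \<open>P\<close> on the right adds all columns to the first. In
    \<open>M t * P = B * W t\<close> the first column of ones in \<open>B\<close> supplies every
    occurrence of \<open>t\<close>, and \<open>P\<close> and \<open>W t\<close> are
    triangular.\<close>
  define P :: "'b mat" where "P = mat n n (\<lambda>(i, j). if i = j \<or> j = 0 then 1 else 0)"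
  define B where "B = mat n n (\<lambda>(i, j). if j = 0 then 1 else A (vs ! i) (vs ! j))"
  define W where "W t = mat n n (\<lambda>(i, j). if i = j then if j = 0 then r + t * of_nat n else 1
    else if i = 0 then t else 0)" for t
  define M where "M t = mat n n (\<lambda>(i, j). A (vs ! i) (vs ! j) + t)" for t
  have [simp]: "P \<in> carrier_mat n n" "B \<in> carrier_mat n n" "W t \<in> carrier_mat n n"
    "M t \<in> carrier_mat n n" for t
    by (auto simp: P_def B_def W_def M_def)
  have row_sum: "(\<Sum>j = 0..<n. A (vs ! i) (vs ! j)) = r" if "i < n" for i
  proof -
    have "(\<Sum>j = 0..<n. A (vs ! i) (vs ! j)) = (\<Sum>y\<in>S. A (vs ! i) y)"
      using sum.reindex_bij_betw[OF bij_betw_nth[OF vs(1) refl vs(2)[symmetric]]]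
      by (simp add: n_def atLeast0LessThan)
    then show ?thesis
      using rows[of "vs ! i"] that vs by (auto simp: n_def)
  qed
  have "M t * P = B * W t" for t
  proof (rule eq_matI)
    fix i j assume "i < dim_row (B * W t)" "j < dim_col (B * W t)"
    then have ij: "i < n" "j < n"
      by (auto simp: B_def W_def)
    have MP: "(M t * P) $$ (i, j) = (\<Sum>k = 0..<n. M t $$ (i, k) * P $$ (k, j))"
      using ij by (simp add: M_def P_def scalar_prod_def)
    have BW: "(B * W t) $$ (i, j) = (\<Sum>k = 0..<n. B $$ (i, k) * W t $$ (k, j))"
      using ij by (simp add: B_def W_def scalar_prod_def)
    show "(M t * P) $$ (i, j) = (B * W t) $$ (i, j)"
    proof (cases "j = 0")
      case True
      have "(\<Sum>k = 0..<n. M t $$ (i, k) * P $$ (k, j)) = (\<Sum>k = 0..<n. A (vs ! i) (vs ! k) + t)"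
        using ij True by (intro sum.cong) (auto simp: M_def P_def)
      also have "\<dots> = r + t * of_nat n"
        using ij row_sum by (simp add: sum.distrib mult.commute)
      finally have "(M t * P) $$ (i, j) = r + t * of_nat n"
        using MP by simp
      moreover have "(\<Sum>k = 0..<n. B $$ (i, k) * W t $$ (k, j))
          = (\<Sum>k = 0..<n. if k = 0 then r + t * of_nat n else 0)"
        using ij True by (intro sum.cong) (auto simp: B_def W_def)
      ultimately show ?thesis
        using BW n by simp
    next
      case False
      have "(\<Sum>k = 0..<n. M t $$ (i, k) * P $$ (k, j))
          = (\<Sum>k = 0..<n. if k = j then A (vs ! i) (vs ! j) + t else 0)"
        using ij False by (intro sum.cong) (auto simp: M_def P_def)
      moreover have "(\<Sum>k = 0..<n. B $$ (i, k) * W t $$ (k, j))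
          = (\<Sum>k = 0..<n. (if k = 0 then t else 0) + (if k = j then A (vs ! i) (vs ! j) else 0))"
        using ij False by (intro sum.cong) (auto simp: B_def W_def)
      ultimately show ?thesis
        using MP BW n ij by (simp add: sum.distrib add.commute)
    qed
  qed (auto simp: M_def P_def B_def W_def)
  then have "det (M t) * det P = det B * det (W t)" for t
    using det_mult[of "M t" n P] det_mult[of B n "W t"] by simp
  moreover have "det P = 1"
  proof -
    have "det P = prod_list (diag_mat P)"
      by (rule det_lower_triangular[of n]) (auto simp: P_def)
    also have "\<dots> = (\<Prod>i = 0..<n. P $$ (i, i))"
      by (simp add: prod_list_diag_prod P_def)
    also have "\<dots> = 1"
      by (intro prod.neutral) (auto simp: P_def)
    finally show ?thesis .
  qed
  moreover have "det (W t) = r + t * of_nat n" for t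
  proof -
    have "det (W t) = prod_list (diag_mat (W t))"
      by (rule det_upper_triangular[of _ n]) (auto simp: W_def)
    also have "\<dots> = (\<Prod>i = 0..<n. W t $$ (i, i))"
      by (simp add: prod_list_diag_prod W_def)
    also have "\<dots> = (\<Prod>i = 0..<n. if i = 0 then r + t * of_nat n else 1)"
      by (intro prod.cong) (auto simp: W_def)
    also have "\<dots> = r + t * of_nat n"
      using n by simp
    finally show ?thesis .
  qed
  ultimately have det_M: "det (M t) = det B * (r + t * of_nat n)" for t
    by simp
  have "set_det S (\<lambda>x y. A x y + t) = det (M t)" for t
    using vs by (simp add: set_det_eq_list_det list_det_def M_def n_def)
  \<comment> \<open>At \<open>t = 0\<close> this reads \<open>set_det S A = det B * r\<close>.
    Eliminating \<open>det B\<close> by cross multiplication avoids dividing by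
    \<open>r\<close>.\<close>
  from this[of t] this[of 0] show ?thesis
    using n by (simp add: det_M)
qed simp

section \<open>Comparability graphs of level-regular forests\<close>

definition monic_linear :: "nat \<Rightarrow> int poly" where
  "monic_linear a = [:- int a, 1:]"

lemma monic_linear_neq_0 [simp]: "monic_linear a \<noteq> 0"
  by (simp add: monic_linear_def)

text \<open>Written in the shape of the factor \<open>r + t * of_nat (card S)\<close> of
  \<open>set_det_add_const\<close> at \<open>t = - 1\<close>.\<close>

lemma monic_linear_add: "monic_linear (a + k) = monic_linear a + - 1 * of_nat k"
  by (simp add: monic_linear_def of_nat_poly)

text \<open>
  \<open>d i\<close> is the number of elements below an element of level \<open>i\<close>, itself included; in
  \<open>level_forest\<close>, \<open>b i\<close> is the number of equivalence classes covering a class of level \<open>i\<close>.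
\<close>

locale chain_forest =
  fixes V :: "'a set" and le :: "'a \<Rightarrow> 'a \<Rightarrow> bool" (infix "\<preceq>" 50)
    and lev :: "'a \<Rightarrow> nat" and d :: "nat \<Rightarrow> nat"
  assumes finite_V: "finite V"
    and le_refl: "x \<in> V \<Longrightarrow> x \<preceq> x"
    and le_trans: "x \<in> V \<Longrightarrow> y \<in> V \<Longrightarrow> z \<in> V \<Longrightarrow> x \<preceq> y \<Longrightarrow> y \<preceq> z \<Longrightarrow> x \<preceq> z"
    and lev_mono: "x \<in> V \<Longrightarrow> y \<in> V \<Longrightarrow> x \<preceq> y \<Longrightarrow> lev x \<le> lev y"
    and chain: "x \<in> V \<Longrightarrow> y \<in> V \<Longrightarrow> z \<in> V \<Longrightarrow> x \<preceq> z \<Longrightarrow> y \<preceq> z \<Longrightarrow> lev x \<le> lev y \<Longrightarrow> x \<preceq> y"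
    and pred_ex: "z \<in> V \<Longrightarrow> lev z = Suc i \<Longrightarrow> \<exists>y\<in>V. y \<preceq> z \<and> lev y = i"
    and card_down: "x \<in> V \<Longrightarrow> card {y \<in> V. y \<preceq> x} = d (lev x)"
begin

section \<open>Cones, classes and degrees in a chain forest\<close>

definition below :: "nat \<Rightarrow> nat" where
  "below i = (if i = 0 then 0 else d (i - 1))"

definition csize :: "nat \<Rightarrow> nat" where
  "csize i = d i - below i"

definition up :: "'a \<Rightarrow> 'a set" where
  "up x = {y \<in> V. x \<preceq> y}"

definition proper_up :: "'a \<Rightarrow> 'a set" where
  "proper_up x = {y \<in> V. x \<preceq> y \<and> lev x < lev y}"

definition cls :: "'a \<Rightarrow> 'a set" where
  "cls x = {y \<in> V. x \<preceq> y \<and> lev y = lev x}"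

definition next_lev :: "'a \<Rightarrow> 'a set" where
  "next_lev x = {y \<in> V. x \<preceq> y \<and> lev y = Suc (lev x)}"

definition adj :: "'a \<Rightarrow> 'a \<Rightarrow> bool" where
  "adj x y \<longleftrightarrow> x \<noteq> y \<and> (x \<preceq> y \<or> y \<preceq> x)"

definition deg :: "'a \<Rightarrow> nat" where
  "deg x = card {y \<in> V. adj x y}"

text \<open>The entries of XI - L; since L = D - A, adjacent pairs carry + 1.\<close>

definition lap_char :: "'a \<Rightarrow> 'a \<Rightarrow> int poly" where
  "lap_char x y = (if x = y then monic_linear (deg x) else if adj x y then 1 else 0)"

lemma subset_V: "up x \<subseteq> V" "proper_up x \<subseteq> V" "cls x \<subseteq> V"
  by (auto simp: up_def proper_up_def cls_def)

lemma finite_up [simp]: "finite (up x)" and finite_proper_up [simp]: "finite (proper_up x)"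
  and finite_cls [simp]: "finite (cls x)"
  using subset_V finite_V finite_subset by metis+

lemma mem_up_self: "x \<in> V \<Longrightarrow> x \<in> up x"
  by (simp add: up_def le_refl)

lemma up_eq: "up x = cls x \<union> proper_up x" if "x \<in> V"
  using lev_mono that by (fastforce simp: up_def cls_def proper_up_def)

lemma cls_inter_proper_up: "cls x \<inter> proper_up x = {}"
  by (auto simp: cls_def proper_up_def)

text \<open>The relation is only a preorder. Within one level \<open>chain\<close> makes it
  symmetric, so \<open>cls x\<close> is an equivalence class.\<close>

lemma cls_eq: "cls x = {y \<in> V. y \<preceq> x \<and> lev y = lev x}" if "x \<in> V"
proof -
  have "x \<preceq> y \<longleftrightarrow> y \<preceq> x" if "y \<in> V" "lev y = lev x" for y
    using chain[of y x y] chain[of x y x] that le_refl \<open>x \<in> V\<close> by auto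
  then show ?thesis
    by (auto simp: cls_def)
qed

text \<open>By \<open>chain\<close>, everything of lower level below \<open>x\<close> lies below any
  one predecessor of \<open>x\<close>, so \<open>card_down\<close> one level lower counts
  it.\<close>

lemma card_strictly_below: "card {z \<in> V. z \<preceq> x \<and> lev z < lev x} = below (lev x)" if "x \<in> V"
proof (cases "lev x")
  case (Suc i)
  obtain y where y: "y \<in> V" "y \<preceq> x" "lev y = i"
    using pred_ex \<open>x \<in> V\<close> Suc by blast
  have "z \<preceq> x \<and> lev z < lev x \<longleftrightarrow> z \<preceq> y" if "z \<in> V" for z
    using that y \<open>x \<in> V\<close> Suc chain[of z y x] le_trans[of z y x] lev_mono[of z y] by auto
  then have "{z \<in> V. z \<preceq> x \<and> lev z < lev x} = {z \<in> V. z \<preceq> y}"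
    by auto
  then show ?thesis
    using card_down y Suc by (simp add: below_def)
qed (simp add: below_def)

lemma card_cls: "card (cls x) = csize (lev x)" and below_plus_csize: "below (lev x) + csize (lev x) = d (lev x)"
  and csize_pos: "csize (lev x) > 0" if "x \<in> V"
proof -
  have "{y \<in> V. y \<preceq> x} = cls x \<union> {z \<in> V. z \<preceq> x \<and> lev z < lev x}"
    using cls_eq[OF that] lev_mono that by fastforce
  moreover have "cls x \<inter> {z \<in> V. z \<preceq> x \<and> lev z < lev x} = {}"
    by (auto simp: cls_def)
  ultimately have *: "d (lev x) = card (cls x) + below (lev x)"
    using card_down[OF that] card_strictly_below[OF that] finite_V by (simp add: card_Un_disjoint)
  then show 1: "card (cls x) = csize (lev x)"
    by (simp add: csize_def)
  show "below (lev x) + csize (lev x) = d (lev x)"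
    using * 1 by simp
  have "x \<in> cls x"
    using that by (simp add: cls_def le_refl)
  then show "csize (lev x) > 0"
    using 1 card_gt_0_iff by fastforce
qed

section \<open>Row sums and the determinant recursion\<close>

lemma row_sum:
  assumes "S \<subseteq> V" and "y \<in> S" and "card {z \<in> V - S. adj y z} = k"
  shows "(\<Sum>z\<in>S. lap_char y z) = monic_linear k"
proof -
  have fin: "finite S"
    using assms(1) finite_V finite_subset by blast
  have "{z \<in> V. adj y z} = {z \<in> S. adj y z} \<union> {z \<in> V - S. adj y z}"
    using assms(1) by auto
  then have "deg y = card {z \<in> S. adj y z} + k"
    unfolding deg_def using assms(3) fin finite_V
      card_Un_disjoint[of "{z \<in> S. adj y z}" "{z \<in> V - S. adj y z}"] by auto
  \<comment> \<open>Each neighbour inside \<open>S\<close> contributes 1 to the row and offsets one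
    unit of the degree on the diagonal; only the neighbours outside remain.\<close>
  then have deg: "monic_linear (deg y) + of_nat (card {z \<in> S. adj y z}) = monic_linear k"
    by (simp add: monic_linear_def of_nat_poly)
  have "(\<Sum>z\<in>S. lap_char y z) = lap_char y y + (\<Sum>z\<in>S - {y}. lap_char y z)"
    using fin assms(2) by (rule sum.remove)
  also have "(\<Sum>z\<in>S - {y}. lap_char y z) = (\<Sum>z\<in>S. if adj y z then 1 else 0)"
    using fin by (intro sum.mono_neutral_cong_left) (auto simp: lap_char_def adj_def)
  also have "\<dots> = of_nat (card {z \<in> S. adj y z})"
    using fin by (simp flip: sum.inter_filter)
  finally show ?thesis
    using deg by (simp add: lap_char_def)
qed

text \<open>A neighbour of \<open>y\<close> outside the cone must lie below \<open>y\<close>; by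
  \<open>chain\<close> it is then comparable with \<open>x\<close>, hence below \<open>x\<close> and
  of lower level. This set does not depend on \<open>y\<close>.\<close>

lemma row_sum_up:
  assumes "x \<in> V" and "y \<in> up x"
  shows "(\<Sum>z\<in>up x. lap_char y z) = monic_linear (below (lev x))"
proof (rule row_sum)
  have y: "y \<in> V" "x \<preceq> y"
    using assms by (auto simp: up_def)
  have "adj y z \<and> \<not> x \<preceq> z \<longleftrightarrow> z \<preceq> x \<and> lev z < lev x" if "z \<in> V" for z
    using y \<open>x \<in> V\<close> that chain[of z x y] chain[of x z y] le_trans[of x y z] le_trans[of z x y]
      lev_mono[of x z] unfolding adj_def by (metis not_le order.strict_implies_order)
  then have "{z \<in> V - up x. adj y z} = {z \<in> V. z \<preceq> x \<and> lev z < lev x}"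
    by (auto simp: up_def)
  then show "card {z \<in> V - up x. adj y z} = below (lev x)"
    using card_strictly_below assms by simp
qed (use assms subset_V in simp_all)

text \<open>As for the full cone, except that the class of \<open>x\<close> now lies outside too, so
  all elements below \<open>x\<close> count.\<close>

lemma row_sum_proper_up:
  assumes "x \<in> V" and "y \<in> proper_up x"
  shows "(\<Sum>z\<in>proper_up x. lap_char y z) = monic_linear (d (lev x))"
proof (rule row_sum)
  have y: "y \<in> V" "x \<preceq> y" "lev x < lev y"
    using assms by (auto simp: proper_up_def)
  have "adj y z \<and> \<not> (x \<preceq> z \<and> lev x < lev z) \<longleftrightarrow> z \<preceq> x" if z: "z \<in> V" for z
  proof
    assume *: "adj y z \<and> \<not> (x \<preceq> z \<and> lev x < lev z)"
    have "\<not> y \<preceq> z"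
      using * le_trans[of x y z] lev_mono[of y z] z y \<open>x \<in> V\<close> by auto
    then have "z \<preceq> y"
      using * by (auto simp: adj_def)
    then show "z \<preceq> x"
      using * chain[of z x y] chain[of x z y] z y \<open>x \<in> V\<close> by fastforce
  next
    assume "z \<preceq> x"
    then show "adj y z \<and> \<not> (x \<preceq> z \<and> lev x < lev z)"
      using le_trans[of z x y] lev_mono[of z x] z y \<open>x \<in> V\<close> by (auto simp: adj_def)
  qed
  then have "{z \<in> V - proper_up x. adj y z} = {z \<in> V. z \<preceq> x}"
    by (auto simp: proper_up_def)
  then show "card {z \<in> V - proper_up x. adj y z} = d (lev x)"
    using card_down assms by simp
qed (use assms subset_V in simp_all)

text \<open>Members of a class are comparable with the same elements, namely those below
  \<open>x\<close> and those properly above. \<open>Suc\<close> accounts for \<open>y\<close> itself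
  without subtraction on naturals.\<close>

lemma deg_cls:
  assumes "x \<in> V" and "y \<in> cls x"
  shows "Suc (deg y) = d (lev x) + card (proper_up x)"
proof -
  have y: "y \<in> V" "x \<preceq> y" "y \<preceq> x"
    using assms cls_eq by (auto simp: cls_def)
  have "z \<preceq> y \<longleftrightarrow> z \<preceq> x" and "y \<preceq> z \<longleftrightarrow> x \<preceq> z" if "z \<in> V" for z
    using that y \<open>x \<in> V\<close> le_trans by blast+
  moreover have "x \<preceq> z \<longleftrightarrow> z \<in> cls x \<or> z \<in> proper_up x" if "z \<in> V" for z
    using that up_eq[OF \<open>x \<in> V\<close>] by (auto simp: up_def)
  ultimately have "{z \<in> V. adj y z} = ({z \<in> V. z \<preceq> x} \<union> proper_up x) - {y}"
    using cls_eq[OF \<open>x \<in> V\<close>] subset_V(2)[of x] by (auto simp: adj_def)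
  moreover have "{z \<in> V. z \<preceq> x} \<inter> proper_up x = {}"
    using lev_mono \<open>x \<in> V\<close> by (fastforce simp: proper_up_def)
  then have "card ({z \<in> V. z \<preceq> x} \<union> proper_up x) = d (lev x) + card (proper_up x)"
    using card_down \<open>x \<in> V\<close> finite_V by (simp add: card_Un_disjoint)
  moreover have "y \<in> {z \<in> V. z \<preceq> x} \<union> proper_up x"
    using y by simp
  ultimately show ?thesis
    unfolding deg_def using finite_V card.remove[of "{z \<in> V. z \<preceq> x} \<union> proper_up x" y] by simp
qed

text \<open>Each member of the class lies below the whole cone, so its row consists of ones off the
  diagonal. After the shift the class block is diagonal and the block towards
  \<open>proper_up x\<close> is zero.\<close>

lemma det_up_shifted:
  assumes "x \<in> V"
  shows "set_det (up x) (\<lambda>y z. lap_char y z + - 1) =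
    monic_linear (d (lev x) + card (proper_up x)) ^ csize (lev x) * set_det (proper_up x) (\<lambda>y z. lap_char y z + - 1)"
proof -
  let ?A = "\<lambda>y z. lap_char y z + - 1"
  have off: "?A y z = 0" if "y \<in> cls x" "z \<in> up x" "y \<noteq> z" for y z
  proof -
    have "y \<preceq> z"
      using that assms cls_eq le_trans[of y x z] by (auto simp: up_def)
    then show ?thesis
      using that by (simp add: lap_char_def adj_def)
  qed
  have diag: "?A y y = monic_linear (d (lev x) + card (proper_up x))" if "y \<in> cls x" for y
    using deg_cls[OF assms that, symmetric] by (simp add: lap_char_def monic_linear_def one_pCons)
  have "set_det (cls x \<union> proper_up x) ?A = set_det (cls x) ?A * set_det (proper_up x) ?A"
    using off cls_inter_proper_up[of x] up_eq[OF assms] by (intro set_det_Un) auto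
  moreover have "set_det (cls x) ?A = monic_linear (d (lev x) + card (proper_up x)) ^ card (cls x)"
    using off diag up_eq[OF assms] by (intro set_det_diagonal) auto
  ultimately show ?thesis
    using up_eq card_cls assms by simp
qed

text \<open>
  The vertices of the class of \<open>x\<close> are adjacent to the whole cone above \<open>x\<close>, so subtracting the
  all-ones matrix decouples them; constant row sums undo the subtraction on both sides.
\<close>

lemma det_up_proper_up:
  assumes "x \<in> V"
  shows "monic_linear (d (lev x)) * set_det (up x) lap_char =
    monic_linear (below (lev x)) * monic_linear (d (lev x) + card (proper_up x)) ^ csize (lev x)
      * set_det (proper_up x) lap_char"
proof -
  let ?A = "\<lambda>y z. lap_char y z + - 1"
  define q where "q = monic_linear (d (lev x) + card (proper_up x))"
  define r where "r = monic_linear (below (lev x))"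
  define s where "s = monic_linear (d (lev x))"
  have "card (up x) = csize (lev x) + card (proper_up x)"
    using up_eq[OF assms] cls_inter_proper_up card_cls[OF assms] by (simp add: card_Un_disjoint)
  then have "d (lev x) + card (proper_up x) = below (lev x) + card (up x)"
    using below_plus_csize[OF assms] by simp
  then have "r + - 1 * of_nat (card (up x)) = q"
    unfolding q_def r_def by (simp only: monic_linear_add)
  then have up: "r * set_det (up x) ?A = q * set_det (up x) lap_char"
    using set_det_add_const[of "up x" lap_char r "- 1"] row_sum_up[OF assms] by (simp add: r_def)
  have "s + - 1 * of_nat (card (proper_up x)) = q"
    unfolding q_def s_def by (simp only: monic_linear_add)
  then have proper_up: "s * set_det (proper_up x) ?A = q * set_det (proper_up x) lap_char"
    using set_det_add_const[of "proper_up x" lap_char s "- 1"] row_sum_proper_up[OF assms] by (simp add: s_def)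
  \<comment> \<open>Both uses of \<open>set_det_add_const\<close> produce the same factor
    \<open>q\<close>, because \<open>d (lev x) + card (proper_up x)\<close> equals
    \<open>below (lev x) + card (up x)\<close>. It is nonzero and cancels at the end.\<close>
  have "q * (s * set_det (up x) lap_char) = s * (r * set_det (up x) ?A)"
    using up by (simp add: ac_simps)
  also have "\<dots> = r * q ^ csize (lev x) * (s * set_det (proper_up x) ?A)"
    using det_up_shifted[OF assms] by (simp add: q_def ac_simps)
  also have "\<dots> = q * (r * q ^ csize (lev x) * set_det (proper_up x) lap_char)"
    using proper_up by (simp add: ac_simps)
  finally show ?thesis
    by (simp add: q_def r_def s_def)
qed

section \<open>Splitting a proper cone into the cones one level higher\<close>

lemma up_eq_iff:
  assumes "y \<in> V" and "z \<in> V" and "lev y = lev z"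
  shows "up y = up z \<longleftrightarrow> z \<in> cls y"
proof
  assume "up y = up z"
  then show "z \<in> cls y"
    using mem_up_self[of z] assms by (auto simp: up_def cls_def)
next
  assume "z \<in> cls y"
  then have "y \<preceq> z" "z \<preceq> y"
    using cls_eq[of y] assms by (auto simp: cls_def)
  then show "up y = up z"
    unfolding up_def using assms le_trans by blast
qed

text \<open>Two elements of one level below a common \<open>w\<close> are comparable by
  \<open>chain\<close>, hence in one class. Cones of equal level are thus equal or disjoint.\<close>

lemma up_eq_if_common:
  assumes "y \<in> V" and "z \<in> V" and "lev y = lev z" and "w \<in> up y" and "w \<in> up z"
  shows "up y = up z"
  using assms chain[of y z w] up_eq_iff[of y z] by (auto simp: up_def cls_def)

lemma ex_below_lev:
  assumes "z \<in> V" and "i \<le> lev z"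
  shows "\<exists>y\<in>V. y \<preceq> z \<and> lev y = i"
  using assms(2)
proof (induction i rule: inc_induct)
  case base
  then show ?case
    using assms(1) le_refl by blast
next
  case (step n)
  then obtain y where "y \<in> V" "y \<preceq> z" "lev y = Suc n"
    by blast
  then show ?case
    using pred_ex[of y n] le_trans assms(1) by blast
qed

lemma proper_up_eq_Union:
  assumes "x \<in> V"
  shows "proper_up x = \<Union>(up ` next_lev x)"
proof (intro equalityI subsetI)
  fix z assume z: "z \<in> proper_up x"
  then obtain y where y: "y \<in> V" "y \<preceq> z" "lev y = Suc (lev x)"
    using ex_below_lev[of z "Suc (lev x)"] by (auto simp: proper_up_def)
  then have "x \<preceq> y"
    using chain[of x y z] z assms by (auto simp: proper_up_def)
  then show "z \<in> \<Union>(up ` next_lev x)"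
    using y z by (auto simp: next_lev_def up_def proper_up_def)
next
  fix z assume "z \<in> \<Union>(up ` next_lev x)"
  then obtain y where y: "y \<in> V" "x \<preceq> y" "lev y = Suc (lev x)" "z \<in> V" "y \<preceq> z"
    by (auto simp: next_lev_def up_def)
  then show "z \<in> proper_up x"
    using lev_mono[of y z] le_trans[of x y z] assms by (auto simp: proper_up_def)
qed

lemma disjoint_up_next_lev: "disjoint (up ` next_lev x)"
  unfolding disjoint_def using up_eq_if_common by (fastforce simp: next_lev_def)

text \<open>There are no edges between distinct cones of the next level: the upper end of such an
  edge would lie in both.\<close>

lemma det_proper_up:
  "set_det (proper_up x) lap_char = (\<Prod>C\<in>up ` next_lev x. set_det C lap_char)" if "x \<in> V"
  unfolding proper_up_eq_Union[OF that]
proof (rule set_det_Union)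
  show "finite (up ` next_lev x)"
    using finite_V by (simp add: next_lev_def)
  fix C D y z
  assume CD: "C \<in> up ` next_lev x" "D \<in> up ` next_lev x" "C \<noteq> D" and yz: "y \<in> C" "z \<in> D"
  obtain u v where "u \<in> next_lev x" "v \<in> next_lev x" and uv: "C = up u" "D = up v"
    using CD by blast
  then have u: "u \<in> V" "C = up u" and v: "v \<in> V" "D = up v" and "lev u = lev v"
    by (simp_all add: next_lev_def)
  have "y \<in> V" "z \<in> V" "u \<preceq> y" "v \<preceq> z"
    using u v yz by (auto simp: up_def)
  then have "y \<notin> up v" "z \<notin> up u"
    using up_eq_if_common[of u v] u v \<open>lev u = lev v\<close> CD(3) yz by blast+
  then have "y \<noteq> z" "\<not> y \<preceq> z" "\<not> z \<preceq> y"
    using yz u v \<open>y \<in> V\<close> \<open>z \<in> V\<close> \<open>u \<preceq> y\<close> \<open>v \<preceq> z\<close>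
      le_trans[of u y z] le_trans[of v z y] by (auto simp: up_def)
  then show "lap_char y z = 0"
    by (simp add: lap_char_def adj_def)
qed (use disjoint_up_next_lev in auto)

end

section \<open>Closed formula for level-regular forests\<close>

locale level_forest = chain_forest +
  fixes m :: nat and b :: "nat \<Rightarrow> nat"
  assumes lev_le: "x \<in> V \<Longrightarrow> lev x \<le> m"
    and card_next: "x \<in> V \<Longrightarrow> lev x < m \<Longrightarrow>
      card {y \<in> V. x \<preceq> y \<and> lev y = Suc (lev x)} = b (lev x) * (d (Suc (lev x)) - d (lev x))"
    and b_pos: "i < m \<Longrightarrow> b i > 0"
    and d_Suc: "i < m \<Longrightarrow> d i < d (Suc i)"
begin

text \<open>The number of classes of level \<open>j\<close> in the cone over a class of level
  \<open>i\<close>.\<close>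

definition paths :: "nat \<Rightarrow> nat \<Rightarrow> nat" where
  "paths i j = (\<Prod>t = i..<j. b t)"

definition cone_size :: "nat \<Rightarrow> nat" where
  "cone_size i = (\<Sum>k = i..m. paths i k * csize k)"

text \<open>The minor of a cone of level \<open>i\<close> without its factor
  \<open>monic_linear (below i)\<close>, see \<open>cone\<close>. The exponents
  \<open>csize m - 1\<close> and \<open>b j - 1\<close> reflect the factor
  \<open>monic_linear (d j)\<close> on the left of \<open>det_up_proper_up\<close>, which cancels
  once per class.\<close>

definition cone_poly :: "nat \<Rightarrow> int poly" where
  "cone_poly i = monic_linear (d m) ^ ((csize m - 1) * paths i m)
     * (\<Prod>j = i..<m. monic_linear (d j + b j * cone_size (Suc j)) ^ (csize j * paths i j)
         * monic_linear (d j) ^ ((b j - 1) * paths i j))"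

text \<open>\<open>card_next\<close> counts elements, whereas the recursion needs cones. The fibres
  of \<open>up\<close> on \<open>next_lev x\<close> are classes, all of the same positive size,
  which cancels.\<close>

lemma card_up_next_lev:
  assumes "x \<in> V" and "lev x < m"
  shows "card (up ` next_lev x) = b (lev x)"
proof -
  let ?Y = "next_lev x"
  have fin: "finite ?Y"
    using finite_V by (simp add: next_lev_def)
  have fibre: "card {y \<in> ?Y. up y = C} = csize (Suc (lev x))" if C: "C \<in> up ` ?Y" for C
  proof -
    obtain z where z: "z \<in> ?Y" "C = up z"
      using C by blast
    then have zV: "z \<in> V" "x \<preceq> z" "lev z = Suc (lev x)"
      by (auto simp: next_lev_def)
    have "y \<in> ?Y \<and> up y = up z \<longleftrightarrow> y \<in> cls z" for y
    proof
      assume "y \<in> ?Y \<and> up y = up z"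
      then show "y \<in> cls z"
        using up_eq_iff[of z y] zV by (auto simp: next_lev_def)
    next
      assume y: "y \<in> cls z"
      then have "y \<in> V" "z \<preceq> y" "lev y = lev z"
        by (auto simp: cls_def)
      then show "y \<in> ?Y \<and> up y = up z"
        using up_eq_iff[of z y] zV le_trans[of x z y] assms(1) y by (auto simp: next_lev_def)
    qed
    then have "{y \<in> ?Y. up y = C} = cls z"
      using z by auto
    then show ?thesis
      using card_cls zV by simp
  qed
  have "card ?Y = (\<Sum>C\<in>up ` ?Y. \<Sum>y\<in>{y \<in> ?Y. up y = C}. 1)"
    using sum.image_gen[OF fin, of "\<lambda>_. 1::nat" up] by simp
  also have "\<dots> = card (up ` ?Y) * csize (Suc (lev x))"
    using fibre by simp
  finally have "card (up ` ?Y) * csize (Suc (lev x)) = card ?Y" ..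
  also have "\<dots> = b (lev x) * csize (Suc (lev x))"
    using card_next[OF assms] unfolding next_lev_def csize_def below_def by simp
  finally have "card (up ` ?Y) * csize (Suc (lev x)) = b (lev x) * csize (Suc (lev x))" .
  moreover have "csize (Suc (lev x)) > 0"
    using d_Suc[OF assms(2)] by (simp add: csize_def below_def)
  ultimately show ?thesis
    by simp
qed

lemma paths_simps: "paths i i = 1" "i < j \<Longrightarrow> paths i j = b i * paths (Suc i) j"
  by (simp_all add: paths_def prod.atLeast_Suc_lessThan)

lemma cone_size_top: "cone_size m = csize m"
  by (simp add: cone_size_def paths_simps)

lemma cone_size_step: "cone_size i = csize i + b i * cone_size (Suc i)" if "i < m"
proof -
  have "cone_size i = csize i + (\<Sum>k = Suc i..m. paths i k * csize k)"
    using that by (simp add: cone_size_def sum.atLeast_Suc_atMost paths_simps)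
  also have "(\<Sum>k = Suc i..m. paths i k * csize k) = b i * cone_size (Suc i)"
    unfolding cone_size_def sum_distrib_left by (intro sum.cong) (auto simp: paths_simps)
  finally show ?thesis .
qed

lemma cone_poly_top: "cone_poly m = monic_linear (d m) ^ (csize m - 1)"
  by (simp add: cone_poly_def paths_simps)

text \<open>For \<open>j > i\<close> every exponent is a multiple of
  \<open>paths i j = b i * paths (Suc i) j\<close>, so all factors beyond \<open>j = i\<close> form
  a \<open>b i\<close>-th power.\<close>

lemma cone_poly_step:
  assumes "i < m"
  shows "cone_poly i = monic_linear (d i + b i * cone_size (Suc i)) ^ csize i
    * monic_linear (d i) ^ (b i - 1) * cone_poly (Suc i) ^ b i"
proof -
  define f where "f i j = monic_linear (d j + b j * cone_size (Suc j)) ^ (csize j * paths i j)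
         * monic_linear (d j) ^ ((b j - 1) * paths i j)" for i j
  have "(\<Prod>j = i..<m. f i j) = f i i * (\<Prod>j = Suc i..<m. f i j)"
    using assms by (rule prod.atLeast_Suc_lessThan)
  also have "(\<Prod>j = Suc i..<m. f i j) = (\<Prod>j = Suc i..<m. f (Suc i) j ^ b i)"
  proof (rule prod.cong[OF refl])
    fix j assume "j \<in> {Suc i..<m}"
    then have "paths i j = paths (Suc i) j * b i"
      by (simp add: paths_simps)
    then show "f i j = f (Suc i) j ^ b i"
      unfolding f_def by (simp only: power_mult_distrib power_mult)
  qed
  also have "\<dots> = (\<Prod>j = Suc i..<m. f (Suc i) j) ^ b i"
    by (simp add: prod_power_distrib)
  finally have "(\<Prod>j = i..<m. f i j) = f i i * (\<Prod>j = Suc i..<m. f (Suc i) j) ^ b i" .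
  moreover have "monic_linear (d m) ^ ((csize m - 1) * paths i m) =
      (monic_linear (d m) ^ ((csize m - 1) * paths (Suc i) m)) ^ b i"
    unfolding paths_simps(2)[OF assms] by (simp only: power_mult mult.commute[of "b i"])
  moreover have "f i i = monic_linear (d i + b i * cone_size (Suc i)) ^ csize i * monic_linear (d i) ^ (b i - 1)"
    by (simp add: f_def paths_simps)
  ultimately show ?thesis
    unfolding cone_poly_def f_def[symmetric] by (simp only: power_mult_distrib ac_simps)
qed

lemma card_proper_up:
  assumes "x \<in> V" and "lev x < m" and "\<And>y. y \<in> next_lev x \<Longrightarrow> card (up y) = s"
  shows "card (proper_up x) = b (lev x) * s"
proof -
  have "card (proper_up x) = (\<Sum>C\<in>up ` next_lev x. card C)"
    unfolding proper_up_eq_Union[OF assms(1)]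
    using disjoint_up_next_lev by (intro card_Union_disjoint) (auto simp: disjoint_def pairwise_def disjnt_def)
  also have "\<dots> = (\<Sum>C\<in>up ` next_lev x. s)"
    using assms(3) by (intro sum.cong) auto
  also have "\<dots> = b (lev x) * s"
    using card_up_next_lev[OF assms(1,2)] by simp
  finally show ?thesis .
qed

lemma proper_up_top: "x \<in> V \<Longrightarrow> lev x = m \<Longrightarrow> proper_up x = {}"
  using lev_le by (fastforce simp: proper_up_def)

text \<open>Downward induction from the top level \<open>m\<close>. Size and determinant are treated
  together, since the determinant recursion involves \<open>card (proper_up x)\<close>.\<close>

lemma cone:
  assumes "x \<in> V"
  shows "card (up x) = cone_size (lev x)"
    and "set_det (up x) lap_char = monic_linear (below (lev x)) * cone_poly (lev x)"
proof -
  have "card (up x) = cone_size i \<and> set_det (up x) lap_char = monic_linear (below i) * cone_poly i"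
    if "i \<le> m" "x \<in> V" "lev x = i" for i x
    using that
  proof (induction i arbitrary: x rule: inc_induct)
    case base
    have "proper_up x = {}"
      using base proper_up_top by simp
    moreover have "csize m > 0"
      using base csize_pos by blast
    then have "monic_linear (d m) ^ csize m = monic_linear (d m) * monic_linear (d m) ^ (csize m - 1)"
      by (metis power_minus_mult mult.commute)
    ultimately have "monic_linear (d m) * set_det (up x) lap_char
        = monic_linear (d m) * (monic_linear (below m) * monic_linear (d m) ^ (csize m - 1))"
      using det_up_proper_up[of x] base by (simp add: ac_simps)
    then have "set_det (up x) lap_char = monic_linear (below m) * monic_linear (d m) ^ (csize m - 1)"
      by (subst (asm) mult_cancel_left) simp
    then show ?case
      using up_eq[of x] card_cls[of x] base \<open>proper_up x = {}\<close> by (simp add: cone_poly_top cone_size_top)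
  next
    case (step i)
    let ?s = "monic_linear (d i)" and ?E = "cone_poly (Suc i)"
    have x: "x \<in> V" "lev x = i" "i < m"
      using step by auto
    have IH: "card (up y) = cone_size (Suc i)" "set_det (up y) lap_char = ?s * ?E" if "y \<in> next_lev x" for y
      using step.IH[of y] that x by (auto simp: next_lev_def below_def)
    have h: "card (proper_up x) = b i * cone_size (Suc i)"
      using card_proper_up[OF x(1)] IH(1) x by blast
    then have "card (up x) = cone_size i"
      using up_eq[of x] cls_inter_proper_up[of x] card_cls[of x] x
      by (simp add: card_Un_disjoint cone_size_step)
    moreover have "set_det (proper_up x) lap_char = (\<Prod>C\<in>up ` next_lev x. ?s * ?E)"
      unfolding det_proper_up[OF x(1)] using IH(2) by (intro prod.cong) auto
    then have "set_det (proper_up x) lap_char = (?s * ?E) ^ b i"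
      using card_up_next_lev[OF x(1)] x by simp
    \<comment> \<open>Each of the \<open>b i\<close> cones supplies a factor \<open>?s\<close>; one
      of them cancels against the left side of \<open>det_up_proper_up\<close>.\<close>
    moreover have "?s ^ b i = ?s * ?s ^ (b i - 1)"
      using b_pos[OF x(3)] by (metis power_minus_mult mult.commute)
    then have "(?s * ?E) ^ b i = ?s * (?s ^ (b i - 1) * ?E ^ b i)"
      by (simp only: power_mult_distrib mult.assoc)
    ultimately have "?s * set_det (up x) lap_char = ?s * (monic_linear (below i) * cone_poly i)"
      using det_up_proper_up[OF x(1)] unfolding x(2) h cone_poly_step[OF x(3)] by (simp only: ac_simps)
    then have "set_det (up x) lap_char = monic_linear (below i) * cone_poly i"
      by (subst (asm) mult_cancel_left) simp
    then show ?case
      using \<open>card (up x) = cone_size i\<close> by simp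
  qed
  then show "card (up x) = cone_size (lev x)"
    and "set_det (up x) lap_char = monic_linear (below (lev x)) * cone_poly (lev x)"
    using assms lev_le by auto
qed

end

text \<open>Geometric series; it makes the division in \<open>branching 0\<close> exact.\<close>

lemma pred_dvd_power_pred: "(p - 1) dvd (p ^ n - 1)" for p :: nat
proof (cases "p = 0")
  case False
  then have "int (p ^ n - 1) = int (p - 1) * (\<Sum>i<n. int p ^ i)"
    using power_diff_1_eq[of "int p" n] by (simp add: of_nat_diff)
  then show ?thesis
    by (metis dvd_triv_left of_nat_dvd_iff)
qed (cases n; simp)

section \<open>Power graphs of homocyclic groups\<close>

text \<open>Abstracts from the group of the theorem, in multiplicative notation, the count of
  \<open>p\<close>-th roots that determines how many cyclic subgroups cover a given one.\<close>

locale homocyclic_p_group = group G for G (structure) +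
  fixes p m n :: nat
  assumes prime_p: "prime p" and m_pos: "m > 0" and n_pos: "n > 0"
    and finite_carrier: "finite (carrier G)"
    and exponent: "x \<in> carrier G \<Longrightarrow> x [^] (p ^ m) = \<one>"
    and card_roots: "w \<in> carrier G \<Longrightarrow> w [^] (p ^ (m - 1)) = \<one> \<Longrightarrow>
      card {y \<in> carrier G. y [^] p = w} = p ^ n"
begin

definition is_power :: "'a \<Rightarrow> 'a \<Rightarrow> bool" where
  "is_power x y \<longleftrightarrow> (\<exists>k::nat. x = y [^] k)"

definition height :: "'a \<Rightarrow> nat" where
  "height x = multiplicity p (ord x)"

text \<open>At 0 this counts the subgroups of order \<open>p\<close>; for \<open>0 < i < m\<close>,
  the cyclic subgroups of order \<open>p ^ (i + 1)\<close> containing a given one of order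
  \<open>p ^ i\<close>.\<close>

definition branching :: "nat \<Rightarrow> nat" where
  "branching i = (if i = 0 then (p ^ n - 1) div (p - 1) else p ^ (n - 1))"

lemma p_gt_1: "p > 1"
  using prime_p prime_gt_1_nat by blast

lemma ord_eq: "ord x = p ^ height x" and height_le: "height x \<le> m" if "x \<in> carrier G"
proof -
  have "ord x dvd p ^ m"
    using exponent[OF that] pow_eq_id that by blast
  then obtain i where "i \<le> m" "ord x = p ^ i"
    using divides_primepow_nat[OF prime_p] by blast
  then show "ord x = p ^ height x" "height x \<le> m"
    using prime_p by (simp_all add: height_def)
qed

lemma height_eqI: "x \<in> carrier G \<Longrightarrow> ord x = p ^ i \<Longrightarrow> height x = i"
  using prime_p by (simp add: height_def)

lemma pow_prime_power_eq_one_iff: "x [^] (p ^ i) = \<one> \<longleftrightarrow> height x \<le> i" if "x \<in> carrier G"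
  using pow_eq_id[OF that, of "p ^ i"] ord_eq[OF that] p_gt_1 by (simp add: dvd_power_iff_le)

lemma height_one [simp]: "height \<one> = 0"
  by (simp add: height_def)

lemma height_eq_0_iff: "height x = 0 \<longleftrightarrow> x = \<one>" if "x \<in> carrier G"
  using pow_prime_power_eq_one_iff[OF that, of 0] that by simp

lemma is_power_refl: "x \<in> carrier G \<Longrightarrow> is_power x x"
  by (auto simp: is_power_def intro!: exI[of _ "1::nat"])

lemma is_power_trans: "z \<in> carrier G \<Longrightarrow> is_power x y \<Longrightarrow> is_power y z \<Longrightarrow> is_power x z"
  by (auto simp: is_power_def nat_pow_pow)

lemma is_power_pow: "is_power (x [^] (k::nat)) x"
  by (auto simp: is_power_def)

lemma height_mono: "height x \<le> height y" if "y \<in> carrier G" and xy: "is_power x y"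
proof -
  obtain k where k: "x = y [^] (k::nat)"
    using xy by (auto simp: is_power_def)
  then have "x [^] (p ^ height y) = (y [^] (p ^ height y)) [^] k"
    using that by (simp add: nat_pow_pow mult.commute)
  then have "x [^] (p ^ height y) = \<one>"
    using pow_prime_power_eq_one_iff[of y "height y"] that by simp
  then show ?thesis
    using pow_prime_power_eq_one_iff[of x "height y"] k that by simp
qed

lemma height_pow_prime_power: "height (x [^] (p ^ u)) = height x - u" if "x \<in> carrier G" "u \<le> height x"
proof (rule height_eqI)
  have "p ^ u dvd ord x"
    using that ord_eq by (simp add: le_imp_power_dvd)
  then have "ord (x [^] (p ^ u)) = ord x div p ^ u"
    using that prime_p p_gt_1 by (intro ord_pow) auto
  then show "ord (x [^] (p ^ u)) = p ^ (height x - u)"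
    using that p_gt_1 by (simp add: ord_eq power_diff)
qed (use that in simp)

text \<open>If the gcd of \<open>a\<close> and the order of \<open>z\<close> is
  \<open>p ^ u\<close>, then by Bezout the \<open>a\<close>-th and the \<open>p ^ u\<close>-th power
  of \<open>z\<close> generate the same subgroup.\<close>

lemma power_normal_form:
  assumes "z \<in> carrier G" and "is_power x z"
  obtains u where "u \<le> height z" and "height x = height z - u"
    and "is_power x (z [^] (p ^ u))" and "is_power (z [^] (p ^ u)) x"
proof -
  obtain a where a: "x = z [^] (a::nat)"
    using assms by (auto simp: is_power_def)
  have "gcd a (p ^ height z) dvd p ^ height z"
    by simp
  then obtain u where u: "u \<le> height z" "gcd a (p ^ height z) = p ^ u"
    using divides_primepow_nat[OF prime_p] by blast
  obtain c where "a = p ^ u * c"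
    using u by (metis dvd_def gcd_dvd1)
  then have 1: "is_power x (z [^] (p ^ u))"
    using a assms by (auto simp: is_power_def nat_pow_pow)
  have 2: "is_power (z [^] (p ^ u)) x"
  \<comment> \<open>\<open>bezout_nat\<close> requires a nonzero first argument; for
    \<open>a = 0\<close> the gcd is the order of \<open>z\<close> and both powers are
    trivial.\<close>
  proof (cases "a = 0")
    case True
    then have "p ^ u = p ^ height z" "x = \<one>"
      using u a by simp_all
    then have "z [^] (p ^ u) = \<one>"
      using pow_prime_power_eq_one_iff[of z "height z"] assms by simp
    then show ?thesis
      using is_power_refl[of \<one>] \<open>x = \<one>\<close> by simp
  next
    case False
    then obtain s t where "a * s = p ^ height z * t + p ^ u"
      using bezout_nat[of a "p ^ height z"] unfolding u(2) by blast
    then have "x [^] s = z [^] (p ^ height z * t + p ^ u)"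
      using a assms by (simp add: nat_pow_pow)
    also have "\<dots> = (z [^] (p ^ height z)) [^] t \<otimes> z [^] (p ^ u)"
      using assms by (simp add: nat_pow_pow nat_pow_mult)
    also have "\<dots> = z [^] (p ^ u)"
      using pow_prime_power_eq_one_iff[of z "height z"] assms by simp
    finally show ?thesis
      by (metis is_power_def)
  qed
  have "height x = height (z [^] (p ^ u))"
    using height_mono[OF _ 1] height_mono[OF _ 2] a assms(1) by (intro order_antisym) simp_all
  then show thesis
    using that[OF u(1) _ 1 2] height_pow_prime_power[OF assms(1) u(1)] by simp
qed

text \<open>The elements below \<open>x\<close> form the subgroup generated by \<open>x\<close>. The
  chain property follows by comparing normal forms: a smaller height means a larger exponent of
  \<open>p\<close>.\<close>

sublocale chain_forest "carrier G" is_power height "\<lambda>i. p ^ i"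
proof
  fix x y z assume xyz: "x \<in> carrier G" "y \<in> carrier G" "z \<in> carrier G" "is_power x z" "is_power y z"
    "height x \<le> height y"
  obtain u where u: "u \<le> height z" "height x = height z - u" "is_power x (z [^] (p ^ u))"
    using power_normal_form[of z x] xyz by metis
  obtain v where v: "v \<le> height z" "height y = height z - v" "is_power (z [^] (p ^ v)) y"
    using power_normal_form[of z y] xyz by metis
  have "v \<le> u"
    using u v xyz by simp
  then have "z [^] (p ^ u) = (z [^] (p ^ v)) [^] (p ^ (u - v))"
    using xyz by (simp add: nat_pow_pow flip: power_add)
  then have "is_power (z [^] (p ^ u)) (z [^] (p ^ v))"
    using is_power_pow by metis
  then show "is_power x y"
    using u v xyz is_power_trans by (metis nat_pow_closed)
next
  fix z i assume z: "z \<in> carrier G" "height z = Suc i"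
  then have "height (z [^] p) = i"
    using height_pow_prime_power[of z 1] by simp
  then show "\<exists>y\<in>carrier G. is_power y z \<and> height y = i"
    using z is_power_pow by (metis nat_pow_closed)
next
  fix x assume x: "x \<in> carrier G"
  have "ord x \<noteq> 0"
    using ord_eq[OF x] p_gt_1 by simp
  then have "{y \<in> carrier G. is_power y x} = generate G {x}"
    using generate_pow_nat[OF x] x by (auto simp: is_power_def)
  then show "card {y \<in> carrier G. is_power y x} = p ^ height x"
    using generate_pow_card[OF x] ord_eq[OF x] by simp
next
  show "is_power x z" if "z \<in> carrier G" "is_power x y" "is_power y z" for x y z
    using that by (rule is_power_trans)
  show "height x \<le> height y" if "y \<in> carrier G" "is_power x y" for x y
    using that by (rule height_mono)
qed (fact finite_carrier is_power_refl)+

lemma is_power_one: "x \<in> carrier G \<Longrightarrow> is_power \<one> x"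
  by (auto simp: is_power_def intro!: exI[of _ "0::nat"])

section \<open>Counting the elements one level above a given one\<close>

lemma card_preimage_pow:
  assumes "W \<subseteq> carrier G" and "\<And>w. w \<in> W \<Longrightarrow> height w < m"
  shows "card {y \<in> carrier G. y [^] p \<in> W} = card W * p ^ n"
proof -
  let ?Y = "{y \<in> carrier G. y [^] p \<in> W}"
  have fin: "finite W" "finite ?Y"
    using assms finite_carrier finite_subset by auto
  have roots: "card {y \<in> ?Y. y [^] p = w} = p ^ n" if "w \<in> W" for w
  proof -
    have "w [^] (p ^ (m - 1)) = \<one>"
      using that assms pow_prime_power_eq_one_iff[of w "m - 1"] by fastforce
    moreover have "{y \<in> ?Y. y [^] p = w} = {y \<in> carrier G. y [^] p = w}"
      using that by auto
    ultimately show ?thesis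
      using card_roots that assms(1) by auto
  qed
  have "(\<lambda>y. y [^] p) ` ?Y \<subseteq> W"
    by auto
  then have "card ?Y = (\<Sum>w\<in>W. card {y \<in> ?Y. y [^] p = w})"
    using sum.group[OF fin(2) fin(1), of "\<lambda>y. y [^] p" "\<lambda>_. 1::nat"] by simp
  also have "\<dots> = (\<Sum>w\<in>W. p ^ n)"
    using roots by (intro sum.cong) auto
  also have "\<dots> = card W * p ^ n"
    by simp
  finally show ?thesis .
qed

text \<open>Above the identity these are the nontrivial \<open>p\<close>-th roots of the identity;
  above any other \<open>x\<close> they are the \<open>p\<close>-th roots of the generators of the
  subgroup of \<open>x\<close>.\<close>

lemma card_next_height:
  assumes x: "x \<in> carrier G" and lt: "height x < m"
  shows "card {y \<in> carrier G. is_power x y \<and> height y = Suc (height x)}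
    = branching (height x) * (p ^ Suc (height x) - p ^ height x)"
proof (cases "height x")
  case 0
  then have "x = \<one>"
    using height_eq_0_iff x by simp
  have "y [^] p = \<one> \<and> y \<noteq> \<one> \<longleftrightarrow> height y = 1" if "y \<in> carrier G" for y
    using pow_prime_power_eq_one_iff[OF that, of 1] height_eq_0_iff[OF that] by auto
  then have "{y \<in> carrier G. is_power x y \<and> height y = Suc (height x)}
      = {y \<in> carrier G. y [^] p \<in> {\<one>}} - {\<one>}"
    using 0 \<open>x = \<one>\<close> is_power_one by auto
  then have "card {y \<in> carrier G. is_power x y \<and> height y = Suc (height x)} = p ^ n - 1"
    using card_preimage_pow[of "{\<one>}"] m_pos finite_carrier by simp
  then show ?thesis
    using 0 pred_dvd_power_pred[of p n] by (simp add: branching_def)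
next
  case (Suc j)
  have "is_power x y \<and> height y = Suc (height x) \<longleftrightarrow> y [^] p \<in> cls x" if y: "y \<in> carrier G" for y
  proof
    assume *: "is_power x y \<and> height y = Suc (height x)"
    then have "height (y [^] p) = height x"
      using height_pow_prime_power[of y 1] y by simp
    then show "y [^] p \<in> cls x"
      using chain[of x "y [^] p" y] * x y is_power_pow by (auto simp: cls_def)
  next
    assume "y [^] p \<in> cls x"
    then have *: "is_power x (y [^] p)" "height (y [^] p) = height x"
      by (auto simp: cls_def)
    \<comment> \<open>Otherwise \<open>y\<close> and its \<open>p\<close>-th power would be the
      identity, of height 0. This fails for trivial \<open>x\<close>, whence the case split.\<close>
    have "height y \<noteq> 0"
      using * Suc height_eq_0_iff[OF y] by auto
    then show "is_power x y \<and> height y = Suc (height x)"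
      using height_pow_prime_power[of y 1] * y is_power_trans is_power_pow by auto
  qed
  then have "{y \<in> carrier G. is_power x y \<and> height y = Suc (height x)} = {y \<in> carrier G. y [^] p \<in> cls x}"
    by auto
  then have "card {y \<in> carrier G. is_power x y \<and> height y = Suc (height x)} = csize (height x) * p ^ n"
    using card_preimage_pow[of "cls x"] card_cls[OF x] lt by (auto simp: cls_def)
  also have "\<dots> = (p ^ Suc j - p ^ j) * (p * p ^ (n - 1))"
    using n_pos Suc by (simp add: csize_def below_def power_eq_if[of p n])
  \<comment> \<open>One factor \<open>p\<close> of \<open>p ^ n\<close> turns the class size at
    level \<open>height x\<close> into that of the next level.\<close>
  also have "\<dots> = p ^ (n - 1) * (p ^ Suc (height x) - p ^ height x)"
    using Suc by (simp add: diff_mult_distrib diff_mult_distrib2 ac_simps)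
  finally show ?thesis
    using Suc by (simp add: branching_def)
qed

lemma branching_pos: "branching i > 0"
proof -
  have "p - 1 \<le> p ^ n - 1"
    using p_gt_1 n_pos by (simp add: diff_le_mono self_le_power)
  then show ?thesis
    using p_gt_1 by (simp add: branching_def div_greater_zero_iff)
qed

sublocale level_forest "carrier G" is_power height "\<lambda>i. p ^ i" m branching
proof
  show "p ^ i < p ^ Suc i" for i
    using p_gt_1 by simp
qed (fact height_le card_next_height | rule branching_pos)+

section \<open>The power graph as the cone over the identity\<close>

lemma up_one: "up \<one> = carrier G"
  using is_power_one by (auto simp: up_def)

text \<open>The matrix XI - L is \<open>lap_char\<close> on the cone over the identity; as
  \<open>below 0 = 0\<close>, the extra factor in \<open>cone\<close> is X.\<close>

lemma laplacian_poly_power_graph: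
  assumes "distinct vs" and "set vs = carrier G"
  shows "laplacian_poly (power_graph G) vs = monic_linear 0 * cone_poly 0"
proof -
  have parcs: "(x, y) \<in> parcs (power_graph G) \<longleftrightarrow> adj x y" if "x \<in> carrier G" "y \<in> carrier G" for x y
    using that by (simp add: power_graph_def adj_def is_power_def)
  have degree: "out_degree (with_proj (power_graph G)) x = deg x" if "x \<in> carrier G" for x
  proof -
    have "(x, y) \<in> parcs (power_graph G) \<longleftrightarrow> y \<in> {y \<in> carrier G. adj x y}" for y
      using that by (simp add: power_graph_def adj_def is_power_def)
    then have "out_arcs (with_proj (power_graph G)) x = Pair x ` {y \<in> carrier G. adj x y}"
      unfolding out_arcs_def by force
    then show ?thesis
      by (simp add: out_degree_def deg_def card_image inj_on_def)
  qed
  have "char_poly_matrix (laplacian_mat (power_graph G) vs)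
      = mat (length vs) (length vs) (\<lambda>(i, j). lap_char (vs ! i) (vs ! j))"
  proof (rule eq_matI)
    fix i j
    assume "i < dim_row (mat (length vs) (length vs) (\<lambda>(i, j). lap_char (vs ! i) (vs ! j)))"
      and "j < dim_col (mat (length vs) (length vs) (\<lambda>(i, j). lap_char (vs ! i) (vs ! j)))"
    then have ij: "i < length vs" "j < length vs"
      by simp_all
    then have "vs ! i \<in> carrier G" "vs ! j \<in> carrier G" "vs ! i = vs ! j \<longleftrightarrow> i = j"
      using nth_eq_iff_index_eq[OF assms(1)] nth_mem[of _ vs] unfolding assms(2) by blast+
    then show "char_poly_matrix (laplacian_mat (power_graph G) vs) $$ (i, j)
        = mat (length vs) (length vs) (\<lambda>(i, j). lap_char (vs ! i) (vs ! j)) $$ (i, j)"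
      using ij by (auto simp: char_poly_matrix_def laplacian_mat_def degree_mat_def adjacency_mat_def
          lap_char_def monic_linear_def parcs degree adj_def one_pCons)
  qed (simp_all add: char_poly_matrix_def laplacian_mat_def degree_mat_def adjacency_mat_def)
  then have "laplacian_poly (power_graph G) vs = set_det (carrier G) lap_char"
    using assms by (simp add: laplacian_poly_def char_poly_def set_det_eq_list_det list_det_def)
  then show ?thesis
    using cone(2)[of \<one>] by (simp add: up_one below_def)
qed

section \<open>The constants of the forest in terms of p, m, n and the totient\<close>

lemma paths_Suc: "paths (Suc i) j = p ^ ((j - Suc i) * (n - 1))"
proof -
  have "paths (Suc i) j = (\<Prod>t = Suc i..<j. p ^ (n - 1))"
    unfolding paths_def by (intro prod.cong) (auto simp: branching_def)
  then show ?thesis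
    by (simp add: power_mult[symmetric] mult.commute)
qed

lemma paths_0: "paths 0 j = (p ^ n - 1) div (p - 1) * p ^ ((j - 1) * (n - 1))" if "j > 0"
  unfolding paths_simps(2)[OF that] paths_Suc branching_def by simp

lemma csize_eq_totient: "csize i = totient (p ^ i)"
proof (cases i)
  case (Suc j)
  then show ?thesis
    using totient_prime_power_Suc[OF prime_p, of j]
    by (simp add: csize_def below_def diff_mult_distrib2 mult.commute)
qed (simp add: csize_def below_def)

text \<open>The right-hand side is the number N with index \<open>Suc i\<close> in the
  theorem.\<close>

lemma cone_size_Suc:
  "cone_size (Suc i) = (\<Sum>k = Suc i..m. p ^ ((k - Suc i) * (n - 1)) * totient (p ^ k))"
  by (simp add: cone_size_def paths_Suc csize_eq_totient)

lemma cone_poly_0: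
  assumes "l = (p ^ n - 1) div (p - 1)"
  shows "cone_poly 0 = monic_linear (card (carrier G)) * monic_linear 1 ^ (l - 1)
    * monic_linear (p ^ m) ^ (l * p ^ ((m - 1) * (n - 1)) * (totient (p ^ m) - 1))
    * (\<Prod>i = 1..m - 1. monic_linear (p ^ i) ^ (l * p ^ ((i - 1) * (n - 1)) * (p ^ (n - 1) - 1)))
    * (\<Prod>i = 1..m - 1. monic_linear (p ^ i + p ^ (n - 1) * cone_size (Suc i))
         ^ (l * p ^ ((i - 1) * (n - 1)) * totient (p ^ i)))"
proof -
  define f where "f j = monic_linear (p ^ j + branching j * cone_size (Suc j)) ^ (csize j * paths 0 j)
         * monic_linear (p ^ j) ^ ((branching j - 1) * paths 0 j)" for j
  \<comment> \<open>The cone over the identity is the whole group, so the factor of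
    \<open>cone_poly 0\<close> at \<open>j = 0\<close> yields the root
    \<open>card (carrier G)\<close>.\<close>
  have "card (carrier G) = 1 + l * cone_size 1"
    using cone(1)[of \<one>] cone_size_step[OF m_pos] assms
    by (simp add: up_one branching_def csize_eq_totient)
  then have f0: "f 0 = monic_linear (card (carrier G)) * monic_linear 1 ^ (l - 1)"
    using assms by (simp add: f_def branching_def csize_eq_totient paths_simps)
  have "(\<Prod>j = 0..<m. f j) = f 0 * (\<Prod>j = 1..m - 1. f j)"
    using m_pos prod.atLeast_Suc_lessThan[of 0 m f] by (cases m) (auto simp: atLeastLessThanSuc_atLeastAtMost)
  moreover have "(\<Prod>j = 1..m - 1. f j) =
      (\<Prod>i = 1..m - 1. monic_linear (p ^ i) ^ (l * p ^ ((i - 1) * (n - 1)) * (p ^ (n - 1) - 1))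
        * monic_linear (p ^ i + p ^ (n - 1) * cone_size (Suc i)) ^ (l * p ^ ((i - 1) * (n - 1)) * totient (p ^ i)))"
    using assms by (intro prod.cong) (auto simp: f_def paths_0 branching_def csize_eq_totient ac_simps)
  moreover have "cone_poly 0 = monic_linear (p ^ m) ^ (l * p ^ ((m - 1) * (n - 1)) * (totient (p ^ m) - 1))
      * (\<Prod>j = 0..<m. f j)"
    unfolding cone_poly_def f_def paths_0[OF m_pos] csize_eq_totient assms[symmetric]
    by (simp only: mult.commute)
  ultimately show ?thesis
    unfolding f0 prod.distrib by (simp only: ac_simps)
qed

end

section \<open>Root counting in direct powers of a cyclic group of order p^m\<close>

lemma pow_product_group: "x [^]\<^bsub>product_group I H\<^esub> (k::nat) = (\<lambda>i\<in>I. x i [^]\<^bsub>H i\<^esub> k)"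
  by (induction k) (simp_all add: nat_pow_def cong: restrict_cong)

text \<open>Dividing the congruence by \<open>p\<close> leaves one residue \<open>v\<close> modulo
  \<open>q\<close>, which has the \<open>p\<close> lifts \<open>v + q * t\<close> with
  \<open>0 \<le> t < p\<close>.\<close>

lemma card_division_mod:
  fixes q p :: nat and w :: int
  assumes "p > 0" and "q > 0" and "0 \<le> w" and "w < int (p * q)" and "int p dvd w"
  shows "card {y. 0 \<le> y \<and> y < int (p * q) \<and> int p * y mod int (p * q) = w} = p"
proof -
  obtain v where v: "w = int p * v"
    using assms by blast
  then have v_bounds: "0 \<le> v" "v < int q"
    using assms by (auto simp: zero_le_mult_iff)
  have "int p * y mod int (p * q) = w \<longleftrightarrow> y mod int q = v" for y
    using assms(1) by (simp add: v mult_mod_right[symmetric])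
  then have "{y. 0 \<le> y \<and> y < int (p * q) \<and> int p * y mod int (p * q) = w}
      = (\<lambda>t. v + int q * t) ` {0..<int p}"
  proof (intro equalityI subsetI)
    fix y assume "y \<in> {y. 0 \<le> y \<and> y < int (p * q) \<and> int p * y mod int (p * q) = w}"
    then have y: "0 \<le> y" "y < int p * int q" "y mod int q = v"
      using \<open>\<And>y. int p * y mod int (p * q) = w \<longleftrightarrow> y mod int q = v\<close> by auto
    have eq: "y = v + int q * (y div int q)"
      using y(3) by (metis mod_mult_div_eq)
    then have "int q * (y div int q) < int q * int p"
      using y(2) v_bounds(1) mult.commute[of "int q" "int p"] by linarith
    then have "y div int q \<in> {0..<int p}"
      using y(1) assms(2) by (simp add: pos_imp_zdiv_nonneg_iff)
    with eq show "y \<in> (\<lambda>t. v + int q * t) ` {0..<int p}"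
      by blast
  next
    fix y assume "y \<in> (\<lambda>t. v + int q * t) ` {0..<int p}"
    then obtain t where t: "0 \<le> t" "t + 1 \<le> int p" "y = v + int q * t"
      by auto
    have "int q * (t + 1) \<le> int q * int p"
      using t by (intro mult_left_mono) auto
    then have "y < int (p * q)"
      using t v_bounds by (simp add: algebra_simps)
    moreover have "0 \<le> y" "y mod int q = v"
      using t v_bounds by simp_all
    ultimately show "y \<in> {y. 0 \<le> y \<and> y < int (p * q) \<and> int p * y mod int (p * q) = w}"
      using \<open>\<And>y. int p * y mod int (p * q) = w \<longleftrightarrow> y mod int q = v\<close> by auto
  qed
  moreover have "inj_on (\<lambda>t. v + int q * t) {0..<int p}"
    using assms(2) by (auto simp: inj_on_def)
  ultimately show ?thesis
    by (simp add: card_image)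
qed

text \<open>Powers are computed coordinatewise, so the roots of \<open>w\<close> form a product of
  \<open>n\<close> solution sets, each of size \<open>p\<close>.\<close>

lemma homocyclic_cyclic_power_group:
  assumes "prime p" and "m > 0" and "n > 0"
  shows "homocyclic_p_group (cyclic_power_group (p ^ m) n) p m n"
proof -
  let ?G = "cyclic_power_group (p ^ m) n"
  define M q where "M = p ^ m" and "q = p ^ (m - 1)"
  interpret group ?G
    by (simp add: cyclic_power_group_def)
  have pos: "p > 0" "q > 0" "M > 0"
    using prime_gt_0_nat[OF assms(1)] by (simp_all add: M_def q_def)
  have M: "M = p * q"
    using assms(2) by (cases m) (simp_all add: M_def q_def)
  have carrier: "carrier ?G = (\<Pi>\<^sub>E i\<in>{..<n}. {0..<int M})"
    using pos by (simp add: cyclic_power_group_def carrier_integer_mod_group flip: M_def)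
  have pow: "x [^]\<^bsub>?G\<^esub> (k::nat) = (\<lambda>i\<in>{..<n}. int k * x i mod int M)" for x k
    by (simp add: cyclic_power_group_def pow_product_group flip: M_def)
  have one: "\<one>\<^bsub>?G\<^esub> = (\<lambda>i\<in>{..<n}. 0)"
    by (simp add: cyclic_power_group_def)
  have pow_eq_iff: "y [^]\<^bsub>?G\<^esub> k = w \<longleftrightarrow> (\<forall>i<n. int k * y i mod int M = w i)"
    if "w \<in> carrier ?G" for y w and k :: nat
  proof
    assume "y [^]\<^bsub>?G\<^esub> k = w"
    then show "\<forall>i<n. int k * y i mod int M = w i"
      using pow by (metis lessThan_iff restrict_apply')
  next
    assume "\<forall>i<n. int k * y i mod int M = w i"
    then have "(\<lambda>i\<in>{..<n}. int k * y i mod int M) = w"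
      using that unfolding carrier by (intro extensionalityI[where A = "{..<n}"]) (auto simp: PiE_iff)
    then show "y [^]\<^bsub>?G\<^esub> k = w"
      using pow by simp
  qed
  show ?thesis
  proof
    show "finite (carrier ?G)"
      unfolding carrier by (intro finite_PiE) auto
    show "x [^]\<^bsub>?G\<^esub> (p ^ m) = \<one>\<^bsub>?G\<^esub>" if "x \<in> carrier ?G" for x
      using pow[of x "p ^ m"] one by (simp flip: M_def)
    fix w assume w: "w \<in> carrier ?G" and "w [^]\<^bsub>?G\<^esub> (p ^ (m - 1)) = \<one>\<^bsub>?G\<^esub>"
    then have root: "\<forall>i<n. int q * w i mod int M = \<one>\<^bsub>?G\<^esub> i"
      using pow_eq_iff[OF one_closed, of w q] unfolding q_def by blast
    \<comment> \<open>Being killed by \<open>q = p ^ (m - 1)\<close> makes every coordinate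
      divisible by \<open>p\<close>, which is the solvability condition of
      \<open>card_division_mod\<close>.\<close>
    have dvd: "int p dvd w i" if "i < n" for i
    proof -
      have "int q * w i mod (int q * int p) = 0"
        using root that by (simp add: one M mult.commute)
      then show ?thesis
        using pos(2) by (metis dvd_mult_cancel_left mod_eq_0_iff_dvd of_nat_0_less_iff order_less_irrefl)
    qed
    have "{y \<in> carrier ?G. y [^]\<^bsub>?G\<^esub> p = w}
        = {y \<in> carrier ?G. \<forall>i<n. int p * y i mod int M = w i}"
      using pow_eq_iff[OF w] by blast
    also have "\<dots> = (\<Pi>\<^sub>E i\<in>{..<n}. {y. 0 \<le> y \<and> y < int M \<and> int p * y mod int M = w i})"
      unfolding carrier by (simp add: set_eq_iff PiE_iff) blast
    finally have "card {y \<in> carrier ?G. y [^]\<^bsub>?G\<^esub> p = w}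
        = (\<Prod>i<n. card {y. 0 \<le> y \<and> y < int M \<and> int p * y mod int M = w i})"
      by (simp add: card_PiE)
    also have "\<dots> = (\<Prod>i<n. p)"
    proof (rule prod.cong[OF refl])
      fix i assume "i \<in> {..<n}"
      then show "card {y. 0 \<le> y \<and> y < int M \<and> int p * y mod int M = w i} = p"
        using w dvd pos unfolding carrier M by (intro card_division_mod) (simp_all add: PiE_iff)
    qed
    finally show "card {y \<in> carrier ?G. y [^]\<^bsub>?G\<^esub> p = w} = p ^ n"
      by simp
  qed (use assms in auto)
qed

theorem theorem3p3:
  fixes p m n l :: nat and N :: "nat \<Rightarrow> nat" and vs :: "(nat \<Rightarrow> int) list"
  assumes "prime p" and "m \<ge> 1" and "n \<ge> 1"
    and "l = (p ^ n - 1) div (p - 1)"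
    and "\<And>j. 1 \<le> j \<Longrightarrow> j \<le> m \<Longrightarrow> N j = (\<Sum>k = j..m. p ^ ((k - j) * (n - 1)) * totient (p ^ k))"
    and "distinct vs" and "set vs = pverts (power_graph (cyclic_power_group (p ^ m) n))"
  shows "laplacian_poly (power_graph (cyclic_power_group (p ^ m) n)) vs =
    [:0, 1:] * [:- int (p ^ (m * n)), 1:] * [:- 1, 1:] ^ (l - 1)
    * [:- int (p ^ m), 1:] ^ (l * p ^ ((m - 1) * (n - 1)) * (totient (p ^ m) - 1))
    * (\<Prod>i = 1..m - 1. [:- int (p ^ i), 1:] ^ (l * p ^ ((i - 1) * (n - 1)) * (p ^ (n - 1) - 1)))
    * (\<Prod>i = 1..m - 1. [:- int (p ^ i) - int (p ^ (n - 1) * N (i + 1)), 1:]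
         ^ (l * p ^ ((i - 1) * (n - 1)) * totient (p ^ i)))"
proof -
  let ?G = "cyclic_power_group (p ^ m) n"
  interpret homocyclic_p_group ?G p m n
    using assms by (intro homocyclic_cyclic_power_group) auto
  have card: "card (carrier ?G) = p ^ (m * n)"
    using prime_gt_0_nat[OF assms(1)]
    by (simp add: cyclic_power_group_def carrier_integer_mod_group card_PiE power_mult flip: of_nat_power)
  have lap: "laplacian_poly (power_graph ?G) vs = monic_linear 0 * cone_poly 0"
    using assms by (intro laplacian_poly_power_graph) (auto simp: power_graph_def)
  have factors: "(\<Prod>i = 1..m - 1. monic_linear (p ^ i + p ^ (n - 1) * cone_size (Suc i))
         ^ (l * p ^ ((i - 1) * (n - 1)) * totient (p ^ i)))
      = (\<Prod>i = 1..m - 1. [:- int (p ^ i) - int (p ^ (n - 1) * N (i + 1)), 1:]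
         ^ (l * p ^ ((i - 1) * (n - 1)) * totient (p ^ i)))"
  proof (rule prod.cong[OF refl])
    fix i assume "i \<in> {1..m - 1}"
    \<comment> \<open>\<open>N\<close> is specified only from 1 to \<open>m\<close>; the bound
      \<open>i \<le> m - 1\<close> keeps the index \<open>i + 1\<close> in that range.\<close>
    then have "1 \<le> i + 1" "i + 1 \<le> m"
      using assms(2) by auto
    then have "N (i + 1) = cone_size (Suc i)"
      unfolding cone_size_Suc unfolding Suc_eq_plus1 by (rule assms(5))
    then show "monic_linear (p ^ i + p ^ (n - 1) * cone_size (Suc i)) ^ (l * p ^ ((i - 1) * (n - 1)) * totient (p ^ i))
      = [:- int (p ^ i) - int (p ^ (n - 1) * N (i + 1)), 1:] ^ (l * p ^ ((i - 1) * (n - 1)) * totient (p ^ i))"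
      by (simp add: monic_linear_def)
  qed
  show ?thesis
    unfolding lap cone_poly_0[OF assms(4)] card factors
    by (simp only: monic_linear_def of_nat_0 of_nat_1 minus_zero mult.assoc)
qed

end
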